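(* Let $d\in(-0.5,0)$ and $a>0$, and let $S$ be a subordinator satisfying $\mathbb{E}(S_1^2)<\infty$. Let $S^{a,d}_t=\int_{\mathbb{R}}f_{a,d}(t,u)\,\mathrm{d}S_u$ for $t\in\mathbb{R}$. Let $\Delta>0$ be fixed and let $s+\Delta\le t$ be such that $t-s=h\Delta$ for some $h>0$. Then the two increments $S^{a,d}_{t+\Delta}-S^{a,d}_t$ and $S^{a,d}_{s+\Delta}-S^{a,d}_s$ of length $\Delta$ have covariance $$\gamma_\Delta(h):=\operatorname{Cov}\big(S^{a,d}_{s+(h+1)\Delta}-S^{a,d}_{s+h\Delta},\;S^{a,d}_{s+\Delta}-S^{a,d}_s\big),$$ which satisfies $$\gamma_\Delta(h)\sim\operatorname{Var}(S_1)\,|d|\,a^d\,\Delta^2\,(h\Delta+a)^{d-1},\qquad h\to\infty.$$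
   Context: For $d\in(-0.5,0)$, $a>0$ the modified Mandelbrot-van-Ness kernel is $f_{a,d}(t,s)=(a+(-s)_+)^d-(a+(t-s)_+)^d$ for $t,s\in\mathbb{R}$, where $x_+=\max\{x,0\}$. A subordinator is a L\'evy process with almost surely increasing sample paths. It is extended to a two-sided process $(S_t)_{t\in\mathbb{R}}$ by $S_t=-S^{(1)}_{(-t)-}\mathbf{1}_{\{t<0\}}+S^{(2)}_t\mathbf{1}_{\{t\ge0\}}$, with $S^{(1)},S^{(2)}$ independent identically distributed copies of $S$. The integral defining $S^{a,d}_t$ is the limit in $L^2(\Omega)$ of integrals of approximating step functions. The notation $u(h)\sim v(h)$ as $h\to\infty$ means $u(h)=v(h)(1+o(1))$. *)

theory Defs
  imports "HOL-Probability.Probability" "HOL-Library.Landau_Symbols"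
begin

definition covariance :: "'a measure \<Rightarrow> ('a \<Rightarrow> real) \<Rightarrow> ('a \<Rightarrow> real) \<Rightarrow> real" where
  "covariance M X Y =
     (LINT \<omega>|M. (X \<omega> - (LINT \<omega>'|M. X \<omega>')) * (Y \<omega> - (LINT \<omega>'|M. Y \<omega>')))"

definition mvn_kernel :: "real \<Rightarrow> real \<Rightarrow> real \<Rightarrow> real \<Rightarrow> real" where
  "mvn_kernel a d t s = (a + max (- s) 0) powr d - (a + max (t - s) 0) powr d"

text \<open>
  One-sided processes have type \<^typ>\<open>real \<Rightarrow> 'a \<Rightarrow> real\<close>; only their values at times
  \<open>t \<ge> 0\<close> matter. Stochastic continuity is not listed separately: it follows from
  right-continuity together with stationarity of the increments.
\<close>

definition levy_process :: "'a measure \<Rightarrow> (real \<Rightarrow> 'a \<Rightarrow> real) \<Rightarrow> bool" where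
  "levy_process M S \<longleftrightarrow>
     prob_space M \<and>
     (\<forall>t\<ge>0. S t \<in> borel_measurable M) \<and>
     (AE \<omega> in M. S 0 \<omega> = 0) \<and>
     (\<forall>n (\<tau> :: nat \<Rightarrow> real). 0 \<le> \<tau> 0 \<and> (\<forall>i<n. \<tau> i \<le> \<tau> (Suc i)) \<longrightarrow>
        prob_space.indep_vars M (\<lambda>_. borel) (\<lambda>i \<omega>. S (\<tau> (Suc i)) \<omega> - S (\<tau> i) \<omega>) {..<n}) \<and>
     (\<forall>t\<ge>0. \<forall>r\<ge>0. distr M borel (\<lambda>\<omega>. S (t + r) \<omega> - S t \<omega>) = distr M borel (S r)) \<and>
     (AE \<omega> in M. (\<forall>t\<ge>0. continuous (at_right t) (\<lambda>u. S u \<omega>)) \<and>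
                  (\<forall>t>0. \<exists>l. ((\<lambda>u. S u \<omega>) \<longlongrightarrow> l) (at_left t)))"

definition subordinator :: "'a measure \<Rightarrow> (real \<Rightarrow> 'a \<Rightarrow> real) \<Rightarrow> bool" where
  "subordinator M S \<longleftrightarrow>
     levy_process M S \<and> (AE \<omega> in M. mono_on {0..} (\<lambda>t. S t \<omega>))"

definition path_law :: "'a measure \<Rightarrow> (real \<Rightarrow> 'a \<Rightarrow> real) \<Rightarrow> (real \<Rightarrow> real) measure" where
  "path_law M S = distr M (PiM {0..} (\<lambda>_. borel)) (\<lambda>\<omega>. \<lambda>t\<in>{0..}. S t \<omega>)"

text \<open>
  The law on the product sigma-algebra does not determine path regularity, so being a
  subordinator is required of the two copies explicitly.
\<close>

definition independent_copies ::
  "'b measure \<Rightarrow> (real \<Rightarrow> 'b \<Rightarrow> real) \<Rightarrow> 'a measure \<Rightarrow>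
   (real \<Rightarrow> 'a \<Rightarrow> real) \<Rightarrow> (real \<Rightarrow> 'a \<Rightarrow> real) \<Rightarrow> bool" where
  "independent_copies N S M S1 S2 \<longleftrightarrow>
     subordinator M S1 \<and> subordinator M S2 \<and>
     path_law M S1 = path_law N S \<and> path_law M S2 = path_law N S \<and>
     prob_space.indep_var M
       (PiM {0..} (\<lambda>_. borel)) (\<lambda>\<omega>. \<lambda>t\<in>{0..}. S1 t \<omega>)
       (PiM {0..} (\<lambda>_. borel)) (\<lambda>\<omega>. \<lambda>t\<in>{0..}. S2 t \<omega>)"

text \<open>
  For \<open>t < 0\<close> the value is minus the left limit of \<open>S1\<close> at \<open>-t\<close>; on the null set of paths
  without left limits it is an unspecified number.
\<close>

definition two_sided ::
  "(real \<Rightarrow> 'a \<Rightarrow> real) \<Rightarrow> (real \<Rightarrow> 'a \<Rightarrow> real) \<Rightarrow> real \<Rightarrow> 'a \<Rightarrow> real" where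
  "two_sided S1 S2 t \<omega> =
     (if t < 0 then - Lim (at_left (- t)) (\<lambda>u. S1 u \<omega>) else S2 t \<omega>)"

text \<open>
  A list of triples \<open>(c, l, r)\<close> with \<open>l \<le> r\<close> encodes the step function which is the sum of
  the functions \<open>c\<close> times the indicator of \<open>(l, r]\<close> (overlaps are allowed).
\<close>

type_synonym step = "(real \<times> real \<times> real) list"

definition valid_step :: "step \<Rightarrow> bool" where
  "valid_step p \<longleftrightarrow> (\<forall>(c, l, r) \<in> set p. l \<le> r)"

definition step_fun :: "step \<Rightarrow> real \<Rightarrow> real" where
  "step_fun p u = (\<Sum>(c, l, r)\<leftarrow>p. c * indicator {l<..r} u)"

definition step_integral :: "(real \<Rightarrow> 'a \<Rightarrow> real) \<Rightarrow> step \<Rightarrow> 'a \<Rightarrow> real" where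
  "step_integral Z p \<omega> = (\<Sum>(c, l, r)\<leftarrow>p. c * (Z r \<omega> - Z l \<omega>))"

text \<open>
  The random variable \<open>X\<close> is (a version of) the integral over the real line of the
  deterministic function \<open>f\<close> with respect to the two-sided process \<open>Z\<close>, i.e. the limit in
  \<open>L\<^sup>2\<close> of the probability space of the integrals of step functions approximating \<open>f\<close>.
  As \<open>Z\<close> is not centred, the step functions approximate \<open>f\<close> both in \<open>L\<^sup>1\<close> and in \<open>L\<^sup>2\<close>
  of the real line: \<open>L\<^sup>2\<close> controls the variance and \<open>L\<^sup>1\<close> the mean of the integral.
  The nonnegative integral is insensitive to null sets, so no measurability of \<open>Z\<close> on the
  exceptional null set is needed.
\<close>

definition has_L2_integral ::
  "'a measure \<Rightarrow> (real \<Rightarrow> 'a \<Rightarrow> real) \<Rightarrow> (real \<Rightarrow> real) \<Rightarrow> ('a \<Rightarrow> real) \<Rightarrow> bool" where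
  "has_L2_integral M Z f X \<longleftrightarrow>
     X \<in> borel_measurable M \<and> integrable M (\<lambda>\<omega>. (X \<omega>)\<^sup>2) \<and>
     (\<exists>p :: nat \<Rightarrow> step.
        (\<forall>n. valid_step (p n)) \<and>
        (\<lambda>n. \<integral>\<^sup>+u. ennreal \<bar>step_fun (p n) u - f u\<bar> \<partial>lborel) \<longlonglongrightarrow> 0 \<and>
        (\<lambda>n. \<integral>\<^sup>+u. ennreal ((step_fun (p n) u - f u)\<^sup>2) \<partial>lborel) \<longlonglongrightarrow> 0 \<and>
        (\<lambda>n. \<integral>\<^sup>+\<omega>. ennreal ((step_integral Z (p n) \<omega> - X \<omega>)\<^sup>2) \<partial>M) \<longlonglongrightarrow> 0)"

end

theory Submission
  imports Defs "HOL-Real_Asymp.Real_Asymp"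
begin

text \<open>
  The integral is an isometry up to centring and a factor: for square-integrable \<open>f\<close> and
  \<open>g\<close>, the integrals of \<open>f\<close> and \<open>g\<close> against the two-sided subordinator have covariance
  \<open>Var(S\<^sub>1) \<integral> f(u) g(u) du\<close> (\<open>covariance_two_sided_L2_integral\<close>). For step functions this
  is bilinearity together with one computation: \<open>Z\<^sub>s\<close> and \<open>Z\<^sub>t\<close> have covariance
  \<open>Var(S\<^sub>1) min(|s|, |t|)\<close> when \<open>s\<close> and \<open>t\<close> lie on the same side of 0, and 0 otherwise. In
  general it follows because covariances and scalar products are continuous under
  \<open>L\<^sup>2\<close> convergence.

  The covariance of \<open>Z\<close> rests on two facts about a subordinator with finite second moment.
  Its variance is an additive and nonnegative function of time, hence linear. Its mean is
  linear for the same reason, so the expected jump at a fixed time, being at most the mean of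
  arbitrarily short increments, vanishes. The left limits in the definition of the two-sided
  process may therefore be replaced by values, up to null sets.

  The increment of the kernel over \<open>(t, t + \<Delta>]\<close> is \<open>g(u - t)\<close> with
  \<open>g(u) = (a + (-u)\<^sub>+)\<^sup>d - (a + (\<Delta> - u)\<^sub>+)\<^sup>d\<close>. Hence the covariance in question is
  \<open>Var(S\<^sub>1) J(h\<Delta>)\<close> with \<open>J(H) = \<integral> g(u - H) g(u) du\<close>. As \<open>H\<close> grows, the first factor is
  \<open>|d| \<Delta> (H + a)\<^sup>d\<^sup>-\<^sup>1 (1 + o(1))\<close> for each fixed \<open>u\<close>, by the mean value theorem. Since
  \<open>g\<close> vanishes on the right of \<open>\<Delta>\<close>, the ratio is bounded by a constant where it matters, and
  dominated convergence gives \<open>J(H) \<sim> |d| \<Delta> (H + a)\<^sup>d\<^sup>-\<^sup>1 \<integral> g(u) du\<close>. The last integral is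
  elementary and equals \<open>\<Delta> a\<^sup>d\<close> (\<open>has_bochner_integral_increment_kernel\<close>), which is where
  the factor \<open>a\<^sup>d \<Delta>\<^sup>2\<close> comes from.
\<close>

section \<open>Square-integrable functions\<close>

definition square_integrable :: "'a measure \<Rightarrow> ('a \<Rightarrow> real) \<Rightarrow> bool" where
  "square_integrable M f \<longleftrightarrow> f \<in> borel_measurable M \<and> integrable M (\<lambda>x. (f x)\<^sup>2)"

lemma square_integrable_measurable:
  "square_integrable M f \<Longrightarrow> f \<in> borel_measurable M"
  by (simp add: square_integrable_def)

lemma square_integrable_mult:
  assumes "square_integrable M f" "square_integrable M g"
  shows "integrable M (\<lambda>x. f x * g x)"
proof (rule Bochner_Integration.integrable_bound)
  show "integrable M (\<lambda>x. (f x)\<^sup>2 + (g x)\<^sup>2)"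
    using assms by (auto simp: square_integrable_def)
  show "(\<lambda>x. f x * g x) \<in> borel_measurable M"
    using assms by (auto simp: square_integrable_def)
  have "\<bar>x * y\<bar> \<le> x\<^sup>2 + y\<^sup>2" for x y :: real
    using sum_squares_bound[of "\<bar>x\<bar>" "\<bar>y\<bar>"] abs_ge_zero[of "x * y"]
    by (simp only: abs_mult power2_abs)
  then show "AE x in M. norm (f x * g x) \<le> norm ((f x)\<^sup>2 + (g x)\<^sup>2)"
    by simp
qed

lemma square_integrable_add_scaled:
  assumes "square_integrable M f" "square_integrable M g"
  shows "square_integrable M (\<lambda>x. f x + c * g x)"
proof -
  have "integrable M (\<lambda>x. (f x)\<^sup>2 + 2 * c * (f x * g x) + c\<^sup>2 * (g x)\<^sup>2)"
    using assms square_integrable_mult[OF assms] by (auto simp: square_integrable_def)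
  moreover have "(\<lambda>x. (f x + c * g x)\<^sup>2) = (\<lambda>x. (f x)\<^sup>2 + 2 * c * (f x * g x) + c\<^sup>2 * (g x)\<^sup>2)"
    by (auto simp: power2_eq_square algebra_simps)
  ultimately show ?thesis
    using assms by (auto simp: square_integrable_def)
qed

lemma square_integrable_zero: "square_integrable M (\<lambda>x. 0)"
  by (simp add: square_integrable_def)

lemma square_integrable_add:
  assumes "square_integrable M f" "square_integrable M g"
  shows "square_integrable M (\<lambda>x. f x + g x)"
  using square_integrable_add_scaled[OF assms, of 1] by simp

lemma square_integrable_diff:
  assumes "square_integrable M f" "square_integrable M g"
  shows "square_integrable M (\<lambda>x. f x - g x)"
  using square_integrable_add_scaled[OF assms, of "-1"] by simp

lemma square_integrable_uminus:
  assumes "square_integrable M f"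
  shows "square_integrable M (\<lambda>x. - f x)"
  using square_integrable_diff[OF square_integrable_zero assms] by simp

lemma Cauchy_Schwarz_integral:
  assumes f: "square_integrable M f" and g: "square_integrable M g"
  shows "\<bar>\<integral>x. f x * g x \<partial>M\<bar> \<le> sqrt (\<integral>x. (f x)\<^sup>2 \<partial>M) * sqrt (\<integral>x. (g x)\<^sup>2 \<partial>M)"
proof -
  note [measurable] = f[THEN square_integrable_measurable] g[THEN square_integrable_measurable]
  have int: "integrable M (\<lambda>x. \<bar>f x * g x\<bar>)"
    using square_integrable_mult[OF f g] by simp
  have "(\<integral>\<^sup>+x. ennreal \<bar>f x\<bar> * ennreal \<bar>g x\<bar> \<partial>M)\<^sup>2
      \<le> (\<integral>\<^sup>+x. ennreal \<bar>f x\<bar> ^ 2 \<partial>M) * (\<integral>\<^sup>+x. ennreal \<bar>g x\<bar> ^ 2 \<partial>M)"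
    by (intro Cauchy_Schwarz_nn_integral) auto
  also have "(\<integral>\<^sup>+x. ennreal \<bar>f x\<bar> * ennreal \<bar>g x\<bar> \<partial>M) = ennreal (\<integral>x. \<bar>f x * g x\<bar> \<partial>M)"
    using int by (subst nn_integral_eq_integral[symmetric]) (auto simp: abs_mult ennreal_mult)
  also have "(\<integral>\<^sup>+x. ennreal \<bar>f x\<bar> ^ 2 \<partial>M) = ennreal (\<integral>x. (f x)\<^sup>2 \<partial>M)"
    using f by (subst nn_integral_eq_integral[symmetric])
      (auto simp: square_integrable_def ennreal_power)
  also have "(\<integral>\<^sup>+x. ennreal \<bar>g x\<bar> ^ 2 \<partial>M) = ennreal (\<integral>x. (g x)\<^sup>2 \<partial>M)"
    using g by (subst nn_integral_eq_integral[symmetric])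
      (auto simp: square_integrable_def ennreal_power)
  finally have "(\<integral>x. \<bar>f x * g x\<bar> \<partial>M)\<^sup>2 \<le> (\<integral>x. (f x)\<^sup>2 \<partial>M) * (\<integral>x. (g x)\<^sup>2 \<partial>M)"
    by (simp add: ennreal_power flip: ennreal_mult)
  then have "(\<integral>x. \<bar>f x * g x\<bar> \<partial>M) \<le> sqrt ((\<integral>x. (f x)\<^sup>2 \<partial>M) * (\<integral>x. (g x)\<^sup>2 \<partial>M))"
    by (rule real_le_rsqrt)
  moreover have "\<bar>\<integral>x. f x * g x \<partial>M\<bar> \<le> (\<integral>x. \<bar>f x * g x\<bar> \<partial>M)"
    by (rule integral_abs_bound)
  ultimately show ?thesis
    unfolding real_sqrt_mult by (rule order_trans[rotated])
qed

lemma integral_square_tendsto_0: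
  assumes "\<And>n. square_integrable M (F n)"
    and "(\<lambda>n. \<integral>\<^sup>+x. ennreal ((F n x)\<^sup>2) \<partial>M) \<longlonglongrightarrow> 0"
  shows "(\<lambda>n. \<integral>x. (F n x)\<^sup>2 \<partial>M) \<longlonglongrightarrow> 0"
proof -
  have "(\<integral>\<^sup>+x. ennreal ((F n x)\<^sup>2) \<partial>M) = ennreal (\<integral>x. (F n x)\<^sup>2 \<partial>M)" for n
    using assms(1)[of n] by (intro nn_integral_eq_integral) (auto simp: square_integrable_def)
  then have "(\<lambda>n. ennreal (\<integral>x. (F n x)\<^sup>2 \<partial>M)) \<longlonglongrightarrow> ennreal 0"
    using assms(2) by simp
  then show ?thesis
    by (subst (asm) tendsto_ennreal_iff) auto
qed

text \<open>
  Continuity of the scalar product. It is used both on the probability space, for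
  covariances of step integrals, and on the real line, for the step functions themselves.
\<close>

lemma square_integrable_tendsto_integral_mult:
  assumes F: "\<And>n. square_integrable M (F n)" and G: "\<And>n. square_integrable M (G n)"
    and f: "square_integrable M f" and g: "square_integrable M g"
    and Ff: "(\<lambda>n. \<integral>\<^sup>+x. ennreal ((F n x - f x)\<^sup>2) \<partial>M) \<longlonglongrightarrow> 0"
    and Gg: "(\<lambda>n. \<integral>\<^sup>+x. ennreal ((G n x - g x)\<^sup>2) \<partial>M) \<longlonglongrightarrow> 0"
  shows "(\<lambda>n. \<integral>x. F n x * G n x \<partial>M) \<longlonglongrightarrow> (\<integral>x. f x * g x \<partial>M)"
proof -
  define nrm where "nrm h = sqrt (\<integral>x. (h x)\<^sup>2 \<partial>M)" for h
  note DF = square_integrable_diff[OF F f] and DG = square_integrable_diff[OF G g]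
  have nF: "(\<lambda>n. nrm (\<lambda>x. F n x - f x)) \<longlonglongrightarrow> 0"
    using tendsto_real_sqrt[OF integral_square_tendsto_0[OF DF Ff]] by (simp add: nrm_def)
  have nG: "(\<lambda>n. nrm (\<lambda>x. G n x - g x)) \<longlonglongrightarrow> 0"
    using tendsto_real_sqrt[OF integral_square_tendsto_0[OF DG Gg]] by (simp add: nrm_def)
  have bound: "\<bar>(\<integral>x. F n x * G n x \<partial>M) - (\<integral>x. f x * g x \<partial>M)\<bar>
      \<le> nrm (\<lambda>x. F n x - f x) * nrm (\<lambda>x. G n x - g x)
        + nrm (\<lambda>x. F n x - f x) * nrm g + nrm f * nrm (\<lambda>x. G n x - g x)" for n
  proof -
    note ints = square_integrable_mult[OF DF[of n] DG[of n]] square_integrable_mult[OF DF[of n] g]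
      square_integrable_mult[OF f DG[of n]] square_integrable_mult[OF f g]
    have "(\<integral>x. F n x * G n x \<partial>M) = (\<integral>x. (F n x - f x) * (G n x - g x)
        + (F n x - f x) * g x + f x * (G n x - g x) + f x * g x \<partial>M)"
      by (simp add: algebra_simps)
    also have "\<dots> = (\<integral>x. (F n x - f x) * (G n x - g x) \<partial>M) + (\<integral>x. (F n x - f x) * g x \<partial>M)
        + (\<integral>x. f x * (G n x - g x) \<partial>M) + (\<integral>x. f x * g x \<partial>M)"
      using ints by (simp only: Bochner_Integration.integral_add Bochner_Integration.integrable_add)
    finally show ?thesis
      using Cauchy_Schwarz_integral[OF DF[of n] DG[of n]] Cauchy_Schwarz_integral[OF DF[of n] g]
        Cauchy_Schwarz_integral[OF f DG[of n]] unfolding nrm_def by linarith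
  qed
  have "(\<lambda>n. nrm (\<lambda>x. F n x - f x) * nrm (\<lambda>x. G n x - g x)
        + nrm (\<lambda>x. F n x - f x) * nrm g + nrm f * nrm (\<lambda>x. G n x - g x)) \<longlonglongrightarrow> 0 * 0 + 0 * nrm g + nrm f * 0"
    by (intro tendsto_intros nF nG)
  then have "(\<lambda>n. (\<integral>x. F n x * G n x \<partial>M) - (\<integral>x. f x * g x \<partial>M)) \<longlonglongrightarrow> 0"
    by (intro Lim_null_comparison[OF always_eventually[OF allI, OF bound[unfolded real_norm_def[symmetric]]]]) simp
  then show ?thesis
    by (simp add: LIM_zero_iff)
qed

section \<open>Covariance\<close>

lemma covariance_commute: "covariance M X Y = covariance M Y X"
  by (simp add: covariance_def mult.commute)

context prob_space
begin

lemma square_integrable_integrable: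
  "square_integrable M X \<Longrightarrow> integrable M X"
  unfolding square_integrable_def by (blast intro: square_integrable_imp_integrable)

lemma square_integrable_const: "square_integrable M (\<lambda>_. c)"
  by (simp add: square_integrable_def)

lemma covariance_eq:
  assumes X: "square_integrable M X" and Y: "square_integrable M Y"
  shows "covariance M X Y = expectation (\<lambda>\<omega>. X \<omega> * Y \<omega>) - expectation X * expectation Y"
proof -
  have "covariance M X Y = expectation (\<lambda>\<omega>. X \<omega> * Y \<omega> - expectation X * Y \<omega>
      - expectation Y * X \<omega> + expectation X * expectation Y)"
    unfolding covariance_def by (intro Bochner_Integration.integral_cong) (auto simp: algebra_simps)
  also have "\<dots> = expectation (\<lambda>\<omega>. X \<omega> * Y \<omega>) - expectation X * expectation Y"
    using square_integrable_mult[OF X Y] X[THEN square_integrable_integrable]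
      Y[THEN square_integrable_integrable] by (simp add: prob_space)
  finally show ?thesis .
qed

lemma covariance_cong_AE:
  assumes "square_integrable M X" "square_integrable M Y"
    and "square_integrable M X'" "square_integrable M Y'"
    and "AE \<omega> in M. X \<omega> = X' \<omega>" "AE \<omega> in M. Y \<omega> = Y' \<omega>"
  shows "covariance M X Y = covariance M X' Y'"
proof -
  note [measurable] = assms(1-4)[THEN square_integrable_measurable]
  have "expectation (\<lambda>\<omega>. X \<omega> * Y \<omega>) = expectation (\<lambda>\<omega>. X' \<omega> * Y' \<omega>)"
    "expectation X = expectation X'" "expectation Y = expectation Y'"
    using assms(5,6) by (auto intro!: integral_cong_AE)
  then show ?thesis
    by (simp add: covariance_eq assms(1-4))
qed

lemma covariance_add_scaled_left:
  assumes X: "square_integrable M X" and Y: "square_integrable M Y" and Z: "square_integrable M Z"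
  shows "covariance M (\<lambda>\<omega>. X \<omega> + c * Y \<omega>) Z = covariance M X Z + c * covariance M Y Z"
  using square_integrable_mult[OF X Z] square_integrable_mult[OF Y Z] X[THEN square_integrable_integrable]
      Y[THEN square_integrable_integrable]
  by (simp add: covariance_eq square_integrable_add_scaled X Y Z algebra_simps)

lemma covariance_diff_left:
  assumes "square_integrable M X" "square_integrable M Y" "square_integrable M Z"
  shows "covariance M (\<lambda>\<omega>. X \<omega> - Y \<omega>) Z = covariance M X Z - covariance M Y Z"
  using covariance_add_scaled_left[OF assms, of "-1"] by simp

lemma covariance_diff_right:
  assumes "square_integrable M X" "square_integrable M Y" "square_integrable M Z"
  shows "covariance M Z (\<lambda>\<omega>. X \<omega> - Y \<omega>) = covariance M Z X - covariance M Z Y"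
  using covariance_diff_left[OF assms] by (simp only: covariance_commute[of M Z])

lemma covariance_zero_left: "covariance M (\<lambda>\<omega>. 0) Z = 0"
  by (simp add: covariance_def)

lemma covariance_uminus_left: "covariance M (\<lambda>\<omega>. - X \<omega>) Z = - covariance M X Z"
proof -
  have "covariance M (\<lambda>\<omega>. - X \<omega>) Z = (LINT \<omega>|M. - ((X \<omega> - expectation X) * (Z \<omega> - expectation Z)))"
    unfolding covariance_def by (intro Bochner_Integration.integral_cong) (auto simp: algebra_simps)
  then show ?thesis
    by (simp add: covariance_def)
qed

lemma covariance_self: "covariance M X X = variance X"
  by (simp add: covariance_def power2_eq_square)

lemma covariance_indep:
  assumes "square_integrable M X" "square_integrable M Y" "indep_var borel X borel Y"
  shows "covariance M X Y = 0"
  using indep_var_lebesgue_integral[of X Y] assms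
  by (simp add: covariance_eq square_integrable_integrable)

lemma covariance_tendsto:
  assumes X: "\<And>n. square_integrable M (X n)" and Y: "\<And>n. square_integrable M (Y n)"
    and X': "square_integrable M X'" and Y': "square_integrable M Y'"
    and XX: "(\<lambda>n. \<integral>\<^sup>+\<omega>. ennreal ((X n \<omega> - X' \<omega>)\<^sup>2) \<partial>M) \<longlonglongrightarrow> 0"
    and YY: "(\<lambda>n. \<integral>\<^sup>+\<omega>. ennreal ((Y n \<omega> - Y' \<omega>)\<^sup>2) \<partial>M) \<longlonglongrightarrow> 0"
  shows "(\<lambda>n. covariance M (X n) (Y n)) \<longlonglongrightarrow> covariance M X' Y'"
proof -
  \<comment> \<open>The mean is the scalar product with the constant 1.\<close>
  have "(\<lambda>n. expectation (Z n)) \<longlonglongrightarrow> expectation Z'"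
    if "\<And>n. square_integrable M (Z n)" "square_integrable M Z'"
      "(\<lambda>n. \<integral>\<^sup>+\<omega>. ennreal ((Z n \<omega> - Z' \<omega>)\<^sup>2) \<partial>M) \<longlonglongrightarrow> 0" for Z Z'
    using square_integrable_tendsto_integral_mult[OF that(1) square_integrable_const that(2)
        square_integrable_const that(3), of "\<lambda>_. 1" 1] by simp
  from this[OF X X' XX] this[OF Y Y' YY] show ?thesis
    unfolding covariance_eq[OF X Y] covariance_eq[OF X' Y']
    by (intro tendsto_intros square_integrable_tendsto_integral_mult X Y X' Y' XX YY)
qed

end

section \<open>Moments of a subordinator with finite variance\<close>

text \<open>
  Nonnegativity makes an additive function monotone. Squeezing \<open>(n + 1) t\<close> between
  consecutive integers then determines \<open>\<phi> t\<close> up to \<open>\<phi> 1 / (n + 1)\<close>.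
\<close>

lemma additive_nonneg_imp_linear:
  fixes \<phi> :: "real \<Rightarrow> real"
  assumes add: "\<And>s t. 0 \<le> s \<Longrightarrow> 0 \<le> t \<Longrightarrow> \<phi> (s + t) = \<phi> s + \<phi> t"
    and nonneg: "\<And>t. 0 \<le> t \<Longrightarrow> 0 \<le> \<phi> t"
    and t: "0 \<le> t"
  shows "\<phi> t = t * \<phi> 1"
proof -
  have mono: "\<phi> s \<le> \<phi> t" if "0 \<le> s" "s \<le> t" for s t
    using add[of s "t - s"] nonneg[of "t - s"] that by simp
  have mult: "\<phi> (real n * s) = real n * \<phi> s" if "0 \<le> s" for n s
  proof (induction n)
    case 0
    show ?case using add[of 0 0] by simp
  next
    case (Suc n)
    then show ?case using add[of "real n * s" s] that by (simp add: algebra_simps)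
  qed
  have "\<bar>\<phi> t - t * \<phi> 1\<bar> \<le> inverse (real (Suc n)) * \<phi> 1" for n
  proof -
    define k where "k = nat \<lfloor>real (Suc n) * t\<rfloor>"
    have k: "real k \<le> real (Suc n) * t" "real (Suc n) * t \<le> real k + 1"
      using mult_nonneg_nonneg[of "real (Suc n)" t] t unfolding k_def by linarith+
    have "real k * \<phi> 1 \<le> real (Suc n) * \<phi> t"
      using mono[of "real k" "real (Suc n) * t"] k mult[of 1 k] mult[OF t, of "Suc n"] by simp
    moreover have "real (Suc n) * \<phi> t \<le> (real k + 1) * \<phi> 1"
      using mono[of "real (Suc n) * t" "real (Suc k)"] k mult[of 1 "Suc k"] mult[OF t, of "Suc n"] t
      by (simp add: add.commute)
    moreover have "real k * \<phi> 1 \<le> real (Suc n) * t * \<phi> 1"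
      "real (Suc n) * t * \<phi> 1 \<le> (real k + 1) * \<phi> 1"
      using k nonneg[of 1] by (auto intro!: mult_right_mono)
    ultimately have "\<bar>real (Suc n) * \<phi> t - real (Suc n) * t * \<phi> 1\<bar> \<le> \<phi> 1"
      by (simp add: algebra_simps abs_le_iff)
    also have "real (Suc n) * \<phi> t - real (Suc n) * t * \<phi> 1 = real (Suc n) * (\<phi> t - t * \<phi> 1)"
      by (simp only: right_diff_distrib mult.assoc)
    finally have "real (Suc n) * \<bar>\<phi> t - t * \<phi> 1\<bar> \<le> \<phi> 1"
      by (simp only: abs_mult abs_of_nat)
    then show ?thesis
      by (simp add: field_simps del: of_nat_Suc)
  qed
  moreover have "(\<lambda>n. inverse (real (Suc n)) * \<phi> 1) \<longlonglongrightarrow> 0 * \<phi> 1"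
    by (intro tendsto_intros LIMSEQ_inverse_real_of_nat)
  ultimately have "\<bar>\<phi> t - t * \<phi> 1\<bar> \<le> 0 * \<phi> 1"
    by (intro LIMSEQ_le_const) auto
  then show ?thesis by simp
qed

locale finite_variance_subordinator =
  fixes M :: "'a measure" and S :: "real \<Rightarrow> 'a \<Rightarrow> real"
  assumes subordinator: "subordinator M S"
    and integrable_square: "integrable M (\<lambda>\<omega>. (S 1 \<omega>)\<^sup>2)"

sublocale finite_variance_subordinator \<subseteq> prob_space M
  using subordinator by (simp add: subordinator_def levy_process_def)

context finite_variance_subordinator
begin

lemma levy: "levy_process M S"
  using subordinator by (simp add: subordinator_def)

lemma measurable_S: "0 \<le> t \<Longrightarrow> S t \<in> borel_measurable M"
  using levy by (simp add: levy_process_def)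

lemma AE_S_zero: "AE \<omega> in M. S 0 \<omega> = 0"
  using levy by (simp add: levy_process_def)

lemma AE_mono_S: "AE \<omega> in M. mono_on {0..} (\<lambda>t. S t \<omega>)"
  using subordinator by (simp add: subordinator_def)

lemma distr_increment:
  "0 \<le> t \<Longrightarrow> 0 \<le> r \<Longrightarrow> distr M borel (\<lambda>\<omega>. S (t + r) \<omega> - S t \<omega>) = distr M borel (S r)"
  using levy by (simp add: levy_process_def)

lemma AE_left_limit: "AE \<omega> in M. \<forall>t>0. \<exists>l. ((\<lambda>u. S u \<omega>) \<longlongrightarrow> l) (at_left t)"
  using levy by (auto simp add: levy_process_def)

lemma AE_S_between:
  assumes "0 \<le> s" "s \<le> t"
  shows "AE \<omega> in M. 0 \<le> S s \<omega> \<and> S s \<omega> \<le> S t \<omega>"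
  using AE_mono_S AE_S_zero
proof eventually_elim
  case (elim \<omega>)
  then show ?case
    using assms mono_onD[of "{0..}" "\<lambda>t. S t \<omega>" 0 s] mono_onD[of "{0..}" "\<lambda>t. S t \<omega>" s t] by simp
qed

lemma square_integrable_increment:
  assumes "square_integrable M (S r)" "0 \<le> t" "0 \<le> r"
  shows "square_integrable M (\<lambda>\<omega>. S (t + r) \<omega> - S t \<omega>)"
proof -
  have [measurable]: "(\<lambda>\<omega>. S (t + r) \<omega> - S t \<omega>) \<in> borel_measurable M" "S r \<in> borel_measurable M"
    using assms(2,3) by (auto intro!: borel_measurable_diff measurable_S)
  have "integrable (distr M borel (\<lambda>\<omega>. S (t + r) \<omega> - S t \<omega>)) (\<lambda>x. x\<^sup>2)"
    unfolding distr_increment[OF assms(2,3)]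
    using assms(1) by (simp add: integrable_distr_eq square_integrable_def)
  then show ?thesis
    by (simp add: integrable_distr_eq square_integrable_def)
qed

text \<open>
  On \<open>[0, 1]\<close> the path is dominated by its value at 1 because it is increasing and starts
  at 0. A later time is reached by adding increments of length 1, which have the law of
  \<open>S 1\<close>.
\<close>

lemma square_integrable_S:
  assumes "0 \<le> t"
  shows "square_integrable M (S t)"
proof -
  have base: "square_integrable M (S t)" if "0 \<le> t" "t \<le> 1" for t
  proof -
    note [measurable] = measurable_S[OF that(1)]
    have "integrable M (\<lambda>\<omega>. (S t \<omega>)\<^sup>2)"
    proof (rule Bochner_Integration.integrable_bound[OF integrable_square])
      show "AE \<omega> in M. norm ((S t \<omega>)\<^sup>2) \<le> norm ((S 1 \<omega>)\<^sup>2)"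
        using AE_S_between[OF that] by eventually_elim (auto intro!: power_mono)
    qed measurable
    then show ?thesis by (simp add: square_integrable_def)
  qed
  have "square_integrable M (S t)" if "0 \<le> t" "t \<le> real n" for n t
    using that
  proof (induction n arbitrary: t)
    case 0
    then show ?case using base by simp
  next
    case (Suc n)
    show ?case
    proof (cases "t \<le> 1")
      case False
      have "square_integrable M (S (t - 1))"
        using Suc False by simp
      from square_integrable_add[OF this square_integrable_increment[OF base, of 1 "t - 1"]]
      show ?thesis using False by simp
    qed (use Suc base in simp)
  qed
  then show ?thesis
    using assms real_nat_ceiling_ge by blast
qed

lemma expectation_increment:
  assumes "0 \<le> t" "0 \<le> r"
  shows "expectation (\<lambda>\<omega>. S (t + r) \<omega> - S t \<omega>) = expectation (S r)"
proof -
  have [measurable]: "(\<lambda>\<omega>. S (t + r) \<omega> - S t \<omega>) \<in> borel_measurable M" "S r \<in> borel_measurable M"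
    using assms by (auto intro!: borel_measurable_diff measurable_S)
  have "expectation (\<lambda>\<omega>. S (t + r) \<omega> - S t \<omega>) = (\<integral>x. x \<partial>distr M borel (\<lambda>\<omega>. S (t + r) \<omega> - S t \<omega>))"
    by (simp add: integral_distr)
  also have "\<dots> = expectation (S r)"
    unfolding distr_increment[OF assms] by (simp add: integral_distr)
  finally show ?thesis .
qed

lemma variance_increment:
  assumes "0 \<le> t" "0 \<le> r"
  shows "variance (\<lambda>\<omega>. S (t + r) \<omega> - S t \<omega>) = variance (S r)"
proof -
  have [measurable]: "(\<lambda>\<omega>. S (t + r) \<omega> - S t \<omega>) \<in> borel_measurable M" "S r \<in> borel_measurable M"
    using assms by (auto intro!: borel_measurable_diff measurable_S)
  have "variance (\<lambda>\<omega>. S (t + r) \<omega> - S t \<omega>)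
      = (\<integral>x. (x - expectation (S r))\<^sup>2 \<partial>distr M borel (\<lambda>\<omega>. S (t + r) \<omega> - S t \<omega>))"
    using expectation_increment[OF assms] by (simp add: integral_distr)
  also have "\<dots> = variance (S r)"
    unfolding distr_increment[OF assms] by (simp add: integral_distr)
  finally show ?thesis .
qed

lemma expectation_S:
  assumes "0 \<le> t"
  shows "expectation (S t) = t * expectation (S 1)"
proof (rule additive_nonneg_imp_linear[where \<phi> = "\<lambda>t. expectation (S t)"])
  fix s t :: real
  assume "0 \<le> s" "0 \<le> t"
  then show "expectation (S (s + t)) = expectation (S s) + expectation (S t)"
    using expectation_increment[of s t] square_integrable_integrable[OF square_integrable_S]
    by simp
next
  fix t :: real
  assume "0 \<le> t"
  from AE_S_between[OF this order_refl] show "0 \<le> expectation (S t)"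
    by (intro integral_nonneg_AE) auto
qed fact

lemma covariance_S_increment:
  assumes "0 \<le> s" "s \<le> t"
  shows "covariance M (S s) (\<lambda>\<omega>. S t \<omega> - S s \<omega>) = 0"
proof -
  \<comment> \<open>The independence concerns the increments over \<open>(0, s]\<close> and \<open>(s, t]\<close>, and \<open>S 0\<close> is null.\<close>
  define \<tau> where "\<tau> i = (if i = 0 then 0 else if i = 1 then s else t)" for i :: nat
  have sq: "square_integrable M (S 0)" "square_integrable M (S s)" "square_integrable M (S t)"
    using assms by (auto intro: square_integrable_S)
  note sq' = square_integrable_diff[OF sq(2,1)] square_integrable_diff[OF sq(3,2)]
  have "\<forall>i<2. \<tau> i \<le> \<tau> (Suc i)" "0 \<le> \<tau> 0"
    using assms by (auto simp: \<tau>_def)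
  then have "indep_vars (\<lambda>_. borel) (\<lambda>i \<omega>. S (\<tau> (Suc i)) \<omega> - S (\<tau> i) \<omega>) {..<2}"
    using levy by (simp add: levy_process_def)
  from indep_vars_lebesgue_integral[OF _ this]
  have "expectation (\<lambda>\<omega>. \<Prod>i<2. S (\<tau> (Suc i)) \<omega> - S (\<tau> i) \<omega>)
      = (\<Prod>i<2. expectation (\<lambda>\<omega>. S (\<tau> (Suc i)) \<omega> - S (\<tau> i) \<omega>))"
    using sq'[THEN square_integrable_integrable] by (auto simp: \<tau>_def)
  then have "covariance M (\<lambda>\<omega>. S s \<omega> - S 0 \<omega>) (\<lambda>\<omega>. S t \<omega> - S s \<omega>) = 0"
    by (simp add: covariance_eq[OF sq'] \<tau>_def numeral_2_eq_2)
  also have "covariance M (\<lambda>\<omega>. S s \<omega> - S 0 \<omega>) (\<lambda>\<omega>. S t \<omega> - S s \<omega>)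
      = covariance M (S s) (\<lambda>\<omega>. S t \<omega> - S s \<omega>)"
    using AE_S_zero by (intro covariance_cong_AE sq sq') auto
  finally show ?thesis .
qed

text \<open>
  Independence and stationarity of the increments make the variance additive in time.
\<close>

lemma variance_S:
  assumes "0 \<le> t"
  shows "variance (S t) = t * variance (S 1)"
proof (rule additive_nonneg_imp_linear[where \<phi> = "\<lambda>t. variance (S t)"])
  fix s t :: real
  assume *: "0 \<le> s" "0 \<le> t"
  let ?D = "\<lambda>\<omega>. S (s + t) \<omega> - S s \<omega>"
  have sq: "square_integrable M (S s)" "square_integrable M ?D" "square_integrable M (S (s + t))"
    using * by (auto intro: square_integrable_S square_integrable_increment)
  have "covariance M (S (s + t)) (S (s + t))
      = covariance M (S (s + t)) (S s) + covariance M (S (s + t)) ?D"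
    using covariance_diff_right[OF sq(3,1,3)] by simp
  moreover have "covariance M (S (s + t)) (S s) = covariance M (S s) (S s) + covariance M ?D (S s)"
    using covariance_diff_left[OF sq(3,1,1)] by simp
  moreover have "covariance M (S (s + t)) ?D = covariance M (S s) ?D + covariance M ?D ?D"
    using covariance_diff_left[OF sq(3,1,2)] by simp
  moreover have "covariance M (S s) ?D = 0" "covariance M ?D (S s) = 0"
    using covariance_S_increment[of s "s + t"] * by (simp_all add: covariance_commute[of M ?D])
  ultimately have "variance (S (s + t)) = variance (S s) + variance ?D"
    by (simp add: covariance_self)
  then show "variance (S (s + t)) = variance (S s) + variance (S t)"
    using variance_increment[OF *] by simp
qed (use assms in simp_all)

lemma covariance_S:
  assumes "0 \<le> s" "0 \<le> t"
  shows "covariance M (S s) (S t) = variance (S 1) * min s t"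
proof -
  have *: "covariance M (S s) (S t) = variance (S 1) * s" if "0 \<le> s" "s \<le> t" for s t
  proof -
    have sq: "square_integrable M (S s)" "square_integrable M (S t)"
      using that by (auto intro: square_integrable_S)
    have "covariance M (S s) (S t) = covariance M (S s) (S s)"
      using covariance_S_increment[OF that] covariance_diff_right[OF sq(2,1,1)] by simp
    then show ?thesis
      using variance_S[OF that(1)] by (simp add: covariance_self mult.commute)
  qed
  show ?thesis
    using *[of s t] *[of t s] assms by (cases "s \<le> t") (auto simp: covariance_commute min_def)
qed

text \<open>
  There is no jump at a fixed time: by monotonicity the jump at \<open>t\<close> is at most
  \<open>S t - S u\<close> for every \<open>u < t\<close>, and the mean of that increment is a multiple of \<open>t - u\<close>.
\<close>

lemma AE_left_limit_eq:
  assumes "0 < t"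
  shows "AE \<omega> in M. Lim (at_left t) (\<lambda>u. S u \<omega>) = S t \<omega>"
proof -
  define u where "u n = t * (1 - inverse (real (Suc n)))" for n
  have u: "0 \<le> u n" "u n < t" for n
    using assms by (auto simp: u_def field_simps)
  have "(\<lambda>n. t * (1 - inverse (real (Suc n)))) \<longlonglongrightarrow> t * (1 - 0)"
    by (intro tendsto_intros LIMSEQ_inverse_real_of_nat)
  then have u_lim: "filterlim u (at_left t) sequentially"
    using u less_imp_neq[OF u(2)] by (simp add: filterlim_at u_def[abs_def])
  note [measurable] = measurable_S[OF u(1)] measurable_S[OF less_imp_le[OF assms]]
  \<comment> \<open>The infimum is a measurable bound for the jump, whose own measurability is not clear.\<close>
  define G where "G \<omega> = (INF n. ennreal (S t \<omega> - S (u n) \<omega>))" for \<omega>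
  have [measurable]: "G \<in> borel_measurable M"
    unfolding G_def by measurable
  have jump: "(\<integral>\<^sup>+\<omega>. ennreal (S t \<omega> - S (u n) \<omega>) \<partial>M)
      = ennreal (t * inverse (real (Suc n)) * expectation (S 1))" for n
  proof -
    have "expectation (\<lambda>\<omega>. S t \<omega> - S (u n) \<omega>) = expectation (S (t - u n))"
      using expectation_increment[of "u n" "t - u n"] u[of n] by simp
    also have "\<dots> = (t - u n) * expectation (S 1)"
      using u[of n] by (intro expectation_S) simp
    also have "t - u n = t * inverse (real (Suc n))"
      by (simp add: u_def algebra_simps)
    finally have "expectation (\<lambda>\<omega>. S t \<omega> - S (u n) \<omega>) = t * inverse (real (Suc n)) * expectation (S 1)" .
    moreover have "integrable M (\<lambda>\<omega>. S t \<omega> - S (u n) \<omega>)"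
      using u[of n] by (auto intro!: square_integrable_integrable square_integrable_diff square_integrable_S)
    moreover have "AE \<omega> in M. 0 \<le> S t \<omega> - S (u n) \<omega>"
      using AE_S_between[of "u n" t] u[of n] by auto
    ultimately show ?thesis
      by (simp add: nn_integral_eq_integral)
  qed
  have "(\<integral>\<^sup>+\<omega>. G \<omega> \<partial>M) \<le> ennreal (t * inverse (real (Suc n)) * expectation (S 1))" for n
    unfolding jump[symmetric] G_def by (intro nn_integral_mono INF_lower) auto
  moreover have "(\<lambda>n. ennreal (t * inverse (real (Suc n)) * expectation (S 1)))
      \<longlonglongrightarrow> ennreal (t * 0 * expectation (S 1))"
    by (intro tendsto_intros LIMSEQ_inverse_real_of_nat)
  ultimately have "(\<integral>\<^sup>+\<omega>. G \<omega> \<partial>M) \<le> ennreal (t * 0 * expectation (S 1))"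
    by (intro LIMSEQ_le_const) auto
  then have "AE \<omega> in M. G \<omega> = 0"
    by (simp add: nn_integral_0_iff_AE)
  then show ?thesis
    using AE_left_limit AE_mono_S
  proof eventually_elim
    case (elim \<omega>)
    then obtain l where l: "((\<lambda>u. S u \<omega>) \<longlongrightarrow> l) (at_left t)"
      using assms by blast
    have mono: "S r \<omega> \<le> S r' \<omega>" if "0 \<le> r" "r \<le> r'" for r r'
      using mono_onD[OF elim(3), of r r'] that by simp
    have l_le: "l \<le> S t \<omega>"
    proof (rule tendsto_upperbound[OF l])
      show "eventually (\<lambda>u. S u \<omega> \<le> S t \<omega>) (at_left t)"
        using eventually_at_left_real[OF assms] by eventually_elim (auto intro!: mono)
    qed simp
    have le_l: "S (u n) \<omega> \<le> l" for n
    proof (rule tendsto_lowerbound[OF l])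
      show "eventually (\<lambda>v. S (u n) \<omega> \<le> S v \<omega>) (at_left t)"
        using eventually_at_left_real[OF u(2)[of n]]
        by eventually_elim (use u(1)[of n] in \<open>auto intro!: mono\<close>)
    qed simp
    have "ennreal (S t \<omega> - l) \<le> G \<omega>"
      unfolding G_def by (intro INF_greatest ennreal_leI) (use le_l in simp)
    then have "S t \<omega> \<le> l"
      using elim(1) by (simp add: ennreal_eq_0_iff)
    then have "l = S t \<omega>"
      using l_le by simp
    then show ?case
      using tendsto_Lim[OF _ l] by simp
  qed
qed

end

section \<open>Covariance of integrals against a process with orthogonal increments\<close>

text \<open>
  The integrand whose integral is \<open>Z t\<close> for a two-sided process \<open>Z\<close> vanishing at 0. Its
  differences are the indicators of all half-open intervals, wherever these lie relative to
  0, so that bilinear identities need no case distinction on signs.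
\<close>

definition signed_indicator :: "real \<Rightarrow> real \<Rightarrow> real" where
  "signed_indicator t u = indicator {0<..t} u - indicator {t<..0} u"

lemma indicator_Ioc_eq_signed_indicator:
  "l \<le> r \<Longrightarrow> indicator {l<..r} u = signed_indicator r u - signed_indicator l u"
  by (auto simp: signed_indicator_def split: split_indicator)

lemma square_integrable_signed_indicator: "square_integrable lborel (signed_indicator t)"
  unfolding signed_indicator_def[abs_def]
  by (intro square_integrable_diff)
    (auto simp: square_integrable_def power2_eq_square simp flip: indicator_inter_arith
      intro!: integrable_real_indicator emeasure_bounded_finite)

lemma integral_signed_indicator_mult:
  "(\<integral>u. signed_indicator s u * signed_indicator t u \<partial>lborel)
    = (if 0 \<le> s \<and> 0 \<le> t then min s t else if s < 0 \<and> t < 0 then min (- s) (- t) else 0)"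
proof -
  consider "0 \<le> s" "0 \<le> t" | "s < 0" "t < 0" | "0 \<le> s" "t < 0" | "s < 0" "0 \<le> t"
    by linarith
  then show ?thesis
  proof cases
    case 1
    then have eq: "signed_indicator s u * signed_indicator t u = indicator {0<..min s t} u" for u
      by (auto simp: signed_indicator_def split: split_indicator)
    show ?thesis unfolding eq using 1 by simp
  next
    case 2
    then have eq: "signed_indicator s u * signed_indicator t u = indicator {max s t<..0} u" for u
      by (auto simp: signed_indicator_def split: split_indicator)
    show ?thesis unfolding eq using 2 by (simp add: min_def max_def)
  next
    case 3
    then have eq: "signed_indicator s u * signed_indicator t u = 0" for u
      by (auto simp: signed_indicator_def split: split_indicator)
    show ?thesis unfolding eq using 3 by simp
  next
    case 4
    then have eq: "signed_indicator s u * signed_indicator t u = 0" for u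
      by (auto simp: signed_indicator_def split: split_indicator)
    show ?thesis unfolding eq using 4 by simp
  qed
qed

lemma step_fun_Nil: "step_fun [] = (\<lambda>u. 0)"
  by (simp add: step_fun_def fun_eq_iff)

lemma step_fun_Cons:
  assumes "valid_step ((c, l, r) # p)"
  shows "step_fun ((c, l, r) # p)
    = (\<lambda>u. step_fun p u + c * (signed_indicator r u - signed_indicator l u))"
  using assms indicator_Ioc_eq_signed_indicator[of l r]
  by (simp add: step_fun_def valid_step_def fun_eq_iff)

lemma step_integral_Nil: "step_integral Z [] = (\<lambda>\<omega>. 0)"
  by (simp add: step_integral_def fun_eq_iff)

lemma step_integral_Cons:
  "step_integral Z ((c, l, r) # p) = (\<lambda>\<omega>. step_integral Z p \<omega> + c * (Z r \<omega> - Z l \<omega>))"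
  by (simp add: step_integral_def fun_eq_iff)

lemma valid_step_Cons: "valid_step (x # p) \<Longrightarrow> valid_step p"
  by (simp add: valid_step_def)

lemma square_integrable_step_fun: "valid_step p \<Longrightarrow> square_integrable lborel (step_fun p)"
proof (induction p)
  case Nil
  show ?case by (simp add: step_fun_Nil square_integrable_zero)
next
  case (Cons x p)
  obtain c l r where [simp]: "x = (c, l, r)" by (cases x)
  show ?case
    using square_integrable_add_scaled[OF Cons.IH[OF valid_step_Cons[OF Cons.prems]]
        square_integrable_diff[OF square_integrable_signed_indicator square_integrable_signed_indicator],
        of c r l] Cons.prems
    by (simp add: step_fun_Cons)
qed

lemma square_integrable_step_integral:
  assumes "\<And>t. square_integrable M (Z t)"
  shows "square_integrable M (step_integral Z p)"
proof (induction p)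
  case Nil
  show ?case by (simp add: step_integral_Nil square_integrable_zero)
next
  case (Cons x p)
  obtain c l r where [simp]: "x = (c, l, r)" by (cases x)
  show ?case
    using square_integrable_add_scaled[OF Cons.IH square_integrable_diff[OF assms assms], of c r l]
    by (simp add: step_integral_Cons)
qed

text \<open>
  The approximability required of an integrand already forces it to be square-integrable.
\<close>

lemma square_integrable_limit_of_steps:
  assumes "\<And>n. valid_step (p n)" and [measurable]: "f \<in> borel_measurable borel"
    and lim: "(\<lambda>n. \<integral>\<^sup>+u. ennreal ((step_fun (p n) u - f u)\<^sup>2) \<partial>lborel) \<longlonglongrightarrow> 0"
  shows "square_integrable lborel f"
proof -
  have "eventually (\<lambda>n. (\<integral>\<^sup>+u. ennreal ((step_fun (p n) u - f u)\<^sup>2) \<partial>lborel) < 1) sequentially"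
    using lim by (rule order_tendstoD) simp
  then obtain n where n: "(\<integral>\<^sup>+u. ennreal ((step_fun (p n) u - f u)\<^sup>2) \<partial>lborel) < 1"
    by (auto simp: eventually_sequentially)
  note sq = square_integrable_step_fun[OF assms(1)[of n]]
  have [measurable]: "step_fun (p n) \<in> borel_measurable borel"
    using square_integrable_measurable[OF sq] by simp
  have "square_integrable lborel (\<lambda>u. step_fun (p n) u - f u)"
    unfolding square_integrable_def
    by (auto intro!: integrableI_bounded simp: order.strict_trans[OF n])
  from square_integrable_diff[OF sq this] show ?thesis
    by simp
qed

text \<open>
  In other words, \<open>Z 0\<close> is almost surely constant and two increments of \<open>Z\<close> have
  covariance \<open>v\<close> times the length of the overlap of their intervals.
\<close>

locale orthogonal_increments = prob_space M for M :: "'a measure" +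
  fixes Z :: "real \<Rightarrow> 'a \<Rightarrow> real" and v :: real
  assumes square_integrable_Z: "square_integrable M (Z t)"
    and covariance_Z: "covariance M (Z s) (Z t)
      = v * (\<integral>u. signed_indicator s u * signed_indicator t u \<partial>lborel)"
begin

text \<open>
  Bilinearity is used in one argument at a time: here for the step function, with a single
  time in the other argument.
\<close>

lemma covariance_step_integral_Z:
  assumes "valid_step p"
  shows "covariance M (step_integral Z p) (Z t)
    = v * (\<integral>u. step_fun p u * signed_indicator t u \<partial>lborel)"
  using assms
proof (induction p)
  case Nil
  show ?case by (simp add: step_integral_Nil step_fun_Nil covariance_zero_left)
next
  case (Cons x p)
  obtain c l r where [simp]: "x = (c, l, r)" by (cases x)
  have valid: "valid_step p"
    using valid_step_Cons[OF Cons.prems] .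
  let ?e = signed_indicator
  note sqI = square_integrable_step_integral[OF square_integrable_Z, where p = p]
  note sqD = square_integrable_diff[OF square_integrable_Z square_integrable_Z, of r l]
  note int = square_integrable_mult[OF square_integrable_step_fun[OF valid]
      square_integrable_signed_indicator[of t]]
    square_integrable_mult[OF square_integrable_signed_indicator square_integrable_signed_indicator[of t]]
  have "covariance M (step_integral Z (x # p)) (Z t)
      = covariance M (step_integral Z p) (Z t) + c * (covariance M (Z r) (Z t) - covariance M (Z l) (Z t))"
    by (simp add: step_integral_Cons covariance_add_scaled_left[OF sqI sqD square_integrable_Z]
        covariance_diff_left square_integrable_Z)
  also have "\<dots> = v * ((\<integral>u. step_fun p u * ?e t u \<partial>lborel)
      + c * ((\<integral>u. ?e r u * ?e t u \<partial>lborel) - (\<integral>u. ?e l u * ?e t u \<partial>lborel)))"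
    by (simp add: Cons.IH[OF valid] covariance_Z algebra_simps)
  also have "\<dots> = v * (\<integral>u. step_fun p u * ?e t u + c * (?e r u * ?e t u - ?e l u * ?e t u) \<partial>lborel)"
    using int by simp
  also have "\<dots> = v * (\<integral>u. step_fun (x # p) u * ?e t u \<partial>lborel)"
    using Cons.prems by (simp add: step_fun_Cons algebra_simps)
  finally show ?case .
qed

lemma covariance_step_integral:
  assumes p: "valid_step p" and q: "valid_step q"
  shows "covariance M (step_integral Z p) (step_integral Z q)
    = v * (\<integral>u. step_fun p u * step_fun q u \<partial>lborel)"
  using q
proof (induction q)
  case Nil
  show ?case
    by (simp add: step_integral_Nil step_fun_Nil covariance_zero_left covariance_commute[of _ _ "\<lambda>_. 0"])
next
  case (Cons x q)
  obtain c l r where [simp]: "x = (c, l, r)" by (cases x)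
  have valid: "valid_step q"
    using valid_step_Cons[OF Cons.prems] .
  let ?e = signed_indicator and ?I = "step_integral Z p"
  note sqI = square_integrable_step_integral[OF square_integrable_Z]
  note sqD = square_integrable_diff[OF square_integrable_Z square_integrable_Z, of r l]
  note int = square_integrable_mult[OF square_integrable_step_fun[OF p] square_integrable_step_fun[OF valid]]
    square_integrable_mult[OF square_integrable_step_fun[OF p] square_integrable_signed_indicator]
  have "covariance M ?I (step_integral Z (x # q)) = covariance M (step_integral Z (x # q)) ?I"
    by (rule covariance_commute)
  also have "\<dots> = covariance M (step_integral Z q) ?I
      + c * (covariance M (Z r) ?I - covariance M (Z l) ?I)"
    by (simp add: step_integral_Cons covariance_add_scaled_left[OF sqI sqD sqI]
        covariance_diff_left square_integrable_Z sqI)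
  also have "\<dots> = covariance M ?I (step_integral Z q)
      + c * (covariance M ?I (Z r) - covariance M ?I (Z l))"
    by (simp only: covariance_commute[of M ?I])
  also have "\<dots> = v * ((\<integral>u. step_fun p u * step_fun q u \<partial>lborel)
      + c * ((\<integral>u. step_fun p u * ?e r u \<partial>lborel) - (\<integral>u. step_fun p u * ?e l u \<partial>lborel)))"
    by (simp add: Cons.IH[OF valid] covariance_step_integral_Z[OF p] algebra_simps)
  also have "\<dots> = v * (\<integral>u. step_fun p u * step_fun q u
      + c * (step_fun p u * ?e r u - step_fun p u * ?e l u) \<partial>lborel)"
    using int by simp
  also have "\<dots> = v * (\<integral>u. step_fun p u * step_fun (x # q) u \<partial>lborel)"
    using Cons.prems by (simp add: step_fun_Cons algebra_simps)
  finally show ?case .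
qed

text \<open>
  Both sides of the identity for approximating step functions converge, by the continuity of
  the covariance and of the scalar product.
\<close>

lemma covariance_L2_integral:
  assumes X: "has_L2_integral M Z f X" and Y: "has_L2_integral M Z g Y"
    and [measurable]: "f \<in> borel_measurable borel" "g \<in> borel_measurable borel"
  shows "covariance M X Y = v * (\<integral>u. f u * g u \<partial>lborel)"
proof -
  obtain p where p: "\<And>n. valid_step (p n)"
    "(\<lambda>n. \<integral>\<^sup>+u. ennreal ((step_fun (p n) u - f u)\<^sup>2) \<partial>lborel) \<longlonglongrightarrow> 0"
    "(\<lambda>n. \<integral>\<^sup>+\<omega>. ennreal ((step_integral Z (p n) \<omega> - X \<omega>)\<^sup>2) \<partial>M) \<longlonglongrightarrow> 0"
    using X unfolding has_L2_integral_def by blast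
  obtain q where q: "\<And>n. valid_step (q n)"
    "(\<lambda>n. \<integral>\<^sup>+u. ennreal ((step_fun (q n) u - g u)\<^sup>2) \<partial>lborel) \<longlonglongrightarrow> 0"
    "(\<lambda>n. \<integral>\<^sup>+\<omega>. ennreal ((step_integral Z (q n) \<omega> - Y \<omega>)\<^sup>2) \<partial>M) \<longlonglongrightarrow> 0"
    using Y unfolding has_L2_integral_def by blast
  have sq: "square_integrable M X" "square_integrable M Y"
    using X Y by (auto simp: has_L2_integral_def square_integrable_def)
  have "(\<lambda>n. covariance M (step_integral Z (p n)) (step_integral Z (q n))) \<longlonglongrightarrow> covariance M X Y"
    by (intro covariance_tendsto square_integrable_step_integral square_integrable_Z sq p q)
  moreover have "(\<lambda>n. v * (\<integral>u. step_fun (p n) u * step_fun (q n) u \<partial>lborel))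
      \<longlonglongrightarrow> v * (\<integral>u. f u * g u \<partial>lborel)"
    by (intro tendsto_intros square_integrable_tendsto_integral_mult square_integrable_step_fun p q
        square_integrable_limit_of_steps[OF p(1) _ p(2)] square_integrable_limit_of_steps[OF q(1) _ q(2)]
        assms)
  ultimately show ?thesis
    using covariance_step_integral[OF p(1) q(1)] by (simp add: LIMSEQ_unique)
qed

end

text \<open>
  A step integral involves finitely many times, so modifying the process on a null set that
  depends on the time does not change it almost everywhere.
\<close>

lemma has_L2_integral_cong_AE:
  assumes "\<And>t. AE \<omega> in M. Z t \<omega> = Z' t \<omega>" and "has_L2_integral M Z f X"
  shows "has_L2_integral M Z' f X"
proof -
  have step: "AE \<omega> in M. step_integral Z p \<omega> = step_integral Z' p \<omega>" for p
  proof (induction p)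
    case Nil
    show ?case by (simp add: step_integral_Nil)
  next
    case (Cons x p)
    obtain c l r where [simp]: "x = (c, l, r)" by (cases x)
    show ?case
      using Cons.IH assms(1)[of l] assms(1)[of r]
      by eventually_elim (simp add: step_integral_Cons)
  qed
  have "(\<integral>\<^sup>+\<omega>. ennreal ((step_integral Z p \<omega> - X \<omega>)\<^sup>2) \<partial>M)
      = (\<integral>\<^sup>+\<omega>. ennreal ((step_integral Z' p \<omega> - X \<omega>)\<^sup>2) \<partial>M)" for p
  proof (rule nn_integral_cong_AE)
    show "AE \<omega> in M. ennreal ((step_integral Z p \<omega> - X \<omega>)\<^sup>2)
        = ennreal ((step_integral Z' p \<omega> - X \<omega>)\<^sup>2)"
      using step[of p] by eventually_elim simp
  qed
  then show ?thesis
    using assms(2) by (simp add: has_L2_integral_def)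
qed

section \<open>The two-sided subordinator\<close>

lemma path_law_eq_imp_distr_eq:
  assumes "path_law M S1 = path_law N S" "0 \<le> t"
    and "\<And>t. 0 \<le> t \<Longrightarrow> S1 t \<in> borel_measurable M" "\<And>t. 0 \<le> t \<Longrightarrow> S t \<in> borel_measurable N"
  shows "distr M borel (S1 t) = distr N borel (S t)"
proof -
  have *: "distr M borel (S t) = distr (path_law M S) borel (\<lambda>x. x t)"
    if "\<And>t. 0 \<le> t \<Longrightarrow> S t \<in> borel_measurable M" for M :: "'c measure" and S
  proof -
    have "(\<lambda>\<omega>. \<lambda>t\<in>{0..}. S t \<omega>) \<in> M \<rightarrow>\<^sub>M PiM {0..} (\<lambda>_. borel)"
      using that by (intro measurable_restrict) auto
    moreover have "(\<lambda>x. x t) \<in> PiM {0..} (\<lambda>_. borel) \<rightarrow>\<^sub>M (borel :: real measure)"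
      using assms(2) by (intro measurable_component_singleton) auto
    ultimately show ?thesis
      unfolding path_law_def by (subst distr_distr) (use assms(2) in \<open>auto simp: comp_def\<close>)
  qed
  have "distr M borel (S1 t) = distr (path_law M S1) borel (\<lambda>x. x t)"
    by (rule *[OF assms(3)])
  also have "\<dots> = distr N borel (S t)"
    unfolding assms(1) by (rule *[OF assms(4), symmetric])
  finally show ?thesis .
qed

lemma finite_variance_subordinator_of_path_law:
  assumes N: "finite_variance_subordinator N S" and M: "subordinator M S1"
    and law: "path_law M S1 = path_law N S"
  shows "finite_variance_subordinator M S1"
    and "prob_space.variance M (S1 1) = prob_space.variance N (S 1)"
proof -
  interpret N: finite_variance_subordinator N S by fact
  have meas: "S1 t \<in> borel_measurable M" if "0 \<le> t" for t
    using M that by (simp add: subordinator_def levy_process_def)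
  have [measurable]: "S1 1 \<in> borel_measurable M" "S 1 \<in> borel_measurable N"
    using meas N.measurable_S by simp_all
  have distr: "distr M borel (S1 1) = distr N borel (S 1)"
    by (rule path_law_eq_imp_distr_eq[OF law _ meas N.measurable_S]) simp_all
  have transfer: "(\<integral>\<omega>. h (S1 1 \<omega>) \<partial>M) = (\<integral>\<omega>. h (S 1 \<omega>) \<partial>N)"
    if [measurable]: "h \<in> borel_measurable borel" for h :: "real \<Rightarrow> real"
  proof -
    have "(\<integral>\<omega>. h (S1 1 \<omega>) \<partial>M) = (\<integral>x. h x \<partial>distr M borel (S1 1))"
      by (rule integral_distr[symmetric]) measurable
    also have "\<dots> = (\<integral>\<omega>. h (S 1 \<omega>) \<partial>N)"
      unfolding distr by (rule integral_distr) measurable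
    finally show ?thesis .
  qed
  have "integrable (distr N borel (S 1)) (\<lambda>x. x\<^sup>2)"
    using N.integrable_square by (subst integrable_distr_eq) measurable
  then have "integrable (distr M borel (S1 1)) (\<lambda>x. x\<^sup>2)"
    by (simp only: distr)
  then have "integrable M (\<lambda>\<omega>. (S1 1 \<omega>)\<^sup>2)"
    by (subst (asm) integrable_distr_eq) measurable
  with M show "finite_variance_subordinator M S1"
    by (rule finite_variance_subordinator.intro)
  have "(\<integral>\<omega>. S1 1 \<omega> \<partial>M) = (\<integral>\<omega>. S 1 \<omega> \<partial>N)"
    by (rule transfer) measurable
  then show "(\<integral>\<omega>. (S1 1 \<omega> - (\<integral>\<omega>'. S1 1 \<omega>' \<partial>M))\<^sup>2 \<partial>M) = (\<integral>\<omega>. (S 1 \<omega> - (\<integral>\<omega>'. S 1 \<omega>' \<partial>N))\<^sup>2 \<partial>N)"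
    by (simp only:) (rule transfer, measurable)
qed

text \<open>
  The two-sided process without left limits: a version of it whose values are measurable
  by construction.
\<close>

definition reflected_extension ::
  "(real \<Rightarrow> 'a \<Rightarrow> real) \<Rightarrow> (real \<Rightarrow> 'a \<Rightarrow> real) \<Rightarrow> real \<Rightarrow> 'a \<Rightarrow> real" where
  "reflected_extension S1 S2 t = (if t < 0 then (\<lambda>\<omega>. - S1 (- t) \<omega>) else S2 t)"

lemma AE_two_sided_eq:
  assumes "finite_variance_subordinator M S1"
  shows "AE \<omega> in M. two_sided S1 S2 t \<omega> = reflected_extension S1 S2 t \<omega>"
proof (cases "t < 0")
  case True
  interpret finite_variance_subordinator M S1 by fact
  show ?thesis
    using AE_left_limit_eq[of "- t"] True
    by (auto simp: two_sided_def reflected_extension_def)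
qed (simp add: two_sided_def reflected_extension_def)

text \<open>
  Times on the same side of 0 involve only one of the two copies, whose covariance is
  proportional to the minimum of the two distances from 0; the sign from the reflection enters
  twice. Times on opposite sides are uncorrelated because the copies are independent.
\<close>

lemma orthogonal_increments_reflected_extension:
  assumes "finite_variance_subordinator N S" and indep: "independent_copies N S M S1 S2"
  shows "orthogonal_increments M (reflected_extension S1 S2) (prob_space.variance N (S 1))"
proof -
  let ?v = "prob_space.variance N (S 1)"
  have copies: "subordinator M S1" "subordinator M S2"
    "path_law M S1 = path_law N S" "path_law M S2 = path_law N S"
    using indep by (auto simp: independent_copies_def)
  note S1 = finite_variance_subordinator_of_path_law[OF assms(1) copies(1,3)]
  note S2 = finite_variance_subordinator_of_path_law[OF assms(1) copies(2,4)]
  interpret S1: finite_variance_subordinator M S1 by (rule S1(1))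
  interpret S2: finite_variance_subordinator M S2 by (rule S2(1))
  have cross: "covariance M (S1 s) (S2 t) = 0" if "0 \<le> s" "0 \<le> t" for s t
  proof -
    have "S1.indep_var (PiM {0..} (\<lambda>_. borel)) (\<lambda>\<omega>. \<lambda>t\<in>{0..}. S1 t \<omega>)
       (PiM {0..} (\<lambda>_. borel)) (\<lambda>\<omega>. \<lambda>t\<in>{0..}. S2 t \<omega>)"
      using indep by (simp add: independent_copies_def)
    from S1.indep_var_compose[OF this measurable_component_singleton measurable_component_singleton, of s t]
    have "S1.indep_var borel (S1 s) borel (S2 t)"
      using that by (simp add: comp_def)
    then show ?thesis
      by (intro S1.covariance_indep S1.square_integrable_S S2.square_integrable_S that)
  qed
  show ?thesis
  proof
    show "square_integrable M (reflected_extension S1 S2 t)" for t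
      by (auto simp: reflected_extension_def
          intro!: square_integrable_uminus S1.square_integrable_S S2.square_integrable_S)
    have neg: "covariance M X (\<lambda>\<omega>. - Y \<omega>) = - covariance M X Y" for X Y
      using S1.covariance_uminus_left[of Y X] by (simp only: covariance_commute[of M X])
    show "covariance M (reflected_extension S1 S2 s) (reflected_extension S1 S2 t)
      = ?v * (\<integral>u. signed_indicator s u * signed_indicator t u \<partial>lborel)" for s t
      unfolding integral_signed_indicator_mult reflected_extension_def
      using S1.covariance_S[of "- s" "- t"] S2.covariance_S[of s t] S1(2) S2(2)
        cross[of "- s" t] cross[of "- t" s]
      by (auto simp: neg S1.covariance_uminus_left covariance_commute[of M "S2 s"] not_less)
  qed
qed

lemma covariance_two_sided_L2_integral:
  assumes S: "finite_variance_subordinator N S" and indep: "independent_copies N S M S1 S2"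
    and X: "has_L2_integral M (two_sided S1 S2) f X" and Y: "has_L2_integral M (two_sided S1 S2) g Y"
    and fg: "f \<in> borel_measurable borel" "g \<in> borel_measurable borel"
  shows "covariance M X Y = prob_space.variance N (S 1) * (\<integral>u. f u * g u \<partial>lborel)"
proof -
  have "finite_variance_subordinator M S1"
    by (rule finite_variance_subordinator_of_path_law(1)[OF S])
      (use indep in \<open>simp_all add: independent_copies_def\<close>)
  note eq = AE_two_sided_eq[OF this]
  interpret orthogonal_increments M "reflected_extension S1 S2" "prob_space.variance N (S 1)"
    using S indep by (rule orthogonal_increments_reflected_extension)
  show ?thesis
    by (rule covariance_L2_integral[OF has_L2_integral_cong_AE[OF eq X] has_L2_integral_cong_AE[OF eq Y] fg])
qed

section \<open>Asymptotics of the kernel\<close>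

text \<open>
  The increment over \<open>(0, \<Delta>]\<close> of the modified Mandelbrot-van-Ness kernel in its time
  argument; the increment over \<open>(t, t + \<Delta>]\<close> is its translate by \<open>t\<close>.
\<close>

definition increment_kernel :: "real \<Rightarrow> real \<Rightarrow> real \<Rightarrow> real \<Rightarrow> real" where
  "increment_kernel a d \<Delta> u = (a + max (- u) 0) powr d - (a + max (\<Delta> - u) 0) powr d"

text \<open>
  Mean value theorem: the difference is \<open>|d| \<Delta> \<xi>\<^sup>d\<^sup>-\<^sup>1\<close> for some \<open>\<xi>\<close> between
  \<open>x\<close> and \<open>x + \<Delta>\<close>, and the power decreases in \<open>\<xi>\<close>.
\<close>

lemma powr_increment_bounds:
  fixes x \<Delta> d :: real
  assumes "0 < x" "0 \<le> \<Delta>" "d < 0"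
  shows "\<bar>d\<bar> * \<Delta> * (x + \<Delta>) powr (d - 1) \<le> x powr d - (x + \<Delta>) powr d"
    and "x powr d - (x + \<Delta>) powr d \<le> \<bar>d\<bar> * \<Delta> * x powr (d - 1)"
proof -
  have "\<exists>\<xi>. x \<le> \<xi> \<and> \<xi> \<le> x + \<Delta> \<and> x powr d - (x + \<Delta>) powr d = \<bar>d\<bar> * \<Delta> * \<xi> powr (d - 1)"
  proof (cases "\<Delta> = 0")
    case False
    have "\<exists>z>x. z < x + \<Delta> \<and> (x + \<Delta>) powr d - x powr d = (x + \<Delta> - x) * (d * z powr (d - 1))"
      using assms False by (intro MVT2) (auto intro!: derivative_eq_intros)
    then show ?thesis
      using assms by (auto simp: algebra_simps intro: less_imp_le)
  qed (use assms in auto)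
  then obtain \<xi> where \<xi>: "x \<le> \<xi>" "\<xi> \<le> x + \<Delta>"
    "x powr d - (x + \<Delta>) powr d = \<bar>d\<bar> * \<Delta> * \<xi> powr (d - 1)"
    by blast
  show "\<bar>d\<bar> * \<Delta> * (x + \<Delta>) powr (d - 1) \<le> x powr d - (x + \<Delta>) powr d"
    "x powr d - (x + \<Delta>) powr d \<le> \<bar>d\<bar> * \<Delta> * x powr (d - 1)"
    unfolding \<xi>(3) using assms \<xi>(1,2) by (auto intro!: mult_left_mono powr_mono2')
qed

lemma borel_measurable_increment_kernel [measurable]:
  "increment_kernel a d \<Delta> \<in> borel_measurable borel"
  unfolding increment_kernel_def[abs_def] by measurable

lemma borel_measurable_mvn_kernel [measurable]:
  "mvn_kernel a d t \<in> borel_measurable borel"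
  unfolding mvn_kernel_def[abs_def] by measurable

lemma mvn_kernel_increment:
  "mvn_kernel a d (t + \<Delta>) u - mvn_kernel a d t u = increment_kernel a d \<Delta> (u - t)"
  by (simp add: mvn_kernel_def increment_kernel_def algebra_simps)

context
  fixes a d \<Delta> :: real
  assumes d_gt: "-1 < d" and d_neg: "d < 0" and a_pos: "0 < a" and \<Delta>_pos: "0 < \<Delta>"
begin

lemma increment_kernel_nonneg: "0 \<le> increment_kernel a d \<Delta> u"
  unfolding increment_kernel_def using d_neg a_pos \<Delta>_pos
  by (auto intro!: powr_mono2')

lemma increment_kernel_eq_0: "\<Delta> \<le> u \<Longrightarrow> increment_kernel a d \<Delta> u = 0"
  unfolding increment_kernel_def using \<Delta>_pos by simp

text \<open>
  With \<open>\<phi>(x) = (a + x\<^sub>+)\<^sup>d\<close>, the integral over \<open>x = -u\<close> of \<open>\<phi>(x) - \<phi>(x + \<Delta>)\<close>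
  telescopes: as \<open>\<phi>\<close> vanishes at infinity, only the integral of the constant value
  \<open>a\<^sup>d\<close> over an interval of length \<open>\<Delta>\<close> on the far left remains. The calculation splits at
  \<open>x = 0\<close>, where \<open>\<phi>\<close> changes its formula.
\<close>

lemma has_bochner_integral_increment_kernel:
  "has_bochner_integral lborel (increment_kernel a d \<Delta>) (\<Delta> * a powr d)"
proof (rule has_bochner_integral_nn_integral)
  let ?g = "increment_kernel a d \<Delta>"
  define F1 where "F1 x = a powr d * x - (a + \<Delta> + x) powr (d + 1) / (d + 1)" for x
  define F2 where "F2 x = ((a + x) powr (d + 1) - (a + x + \<Delta>) powr (d + 1)) / (d + 1)" for x
  define f1 where "f1 x = a powr d - (a + \<Delta> + x) powr d" for x
  define f2 where "f2 x = (a + x) powr d - (a + x + \<Delta>) powr d" for x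
  have [measurable]: "f1 \<in> borel_measurable borel" "f2 \<in> borel_measurable borel"
    unfolding f1_def[abs_def] f2_def[abs_def] by measurable
  have I1: "(\<integral>\<^sup>+x. ennreal (f1 x) * indicator {-\<Delta>..0} x \<partial>lborel) = ennreal (F1 0 - F1 (-\<Delta>))"
  proof (rule nn_integral_FTC_Icc)
    fix x assume x: "x \<in> {-\<Delta>..0}"
    then show "DERIV F1 x :> f1 x"
      unfolding F1_def f1_def using d_gt a_pos by (auto intro!: derivative_eq_intros)
    show "0 \<le> f1 x"
      using x a_pos d_neg by (auto simp: f1_def intro!: powr_mono2')
  qed (use \<Delta>_pos in auto)
  have I2: "(\<integral>\<^sup>+x. ennreal (f2 x) * indicator {0..} x \<partial>lborel) = ennreal (0 - F2 0)"
  proof (rule nn_integral_FTC_atLeast)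
    fix x :: real assume x: "0 \<le> x"
    then have "DERIV F2 x :> ((d + 1) * (a + x) powr d - (d + 1) * (a + x + \<Delta>) powr d) / (d + 1)"
      unfolding F2_def using d_gt a_pos \<Delta>_pos by (auto intro!: derivative_eq_intros)
    moreover have "((d + 1) * (a + x) powr d - (d + 1) * (a + x + \<Delta>) powr d) / (d + 1) = f2 x"
      using d_gt by (simp add: f2_def flip: right_diff_distrib)
    ultimately show "DERIV F2 x :> f2 x"
      by simp
    show "0 \<le> f2 x"
      using x a_pos \<Delta>_pos d_neg by (auto simp: f2_def intro!: powr_mono2')
  next
    show "(F2 \<longlongrightarrow> 0) at_top"
    proof (rule Lim_null_comparison)
      \<comment> \<open>The two powers in \<open>F2\<close> grow without bound; their difference is small by the mean value theorem.\<close>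
      have "norm (F2 x) \<le> \<Delta> * (a + x) powr d" if "0 \<le> x" for x
      proof -
        have "\<exists>z>a + x. z < a + x + \<Delta> \<and> (a + x + \<Delta>) powr (d + 1) - (a + x) powr (d + 1)
            = (a + x + \<Delta> - (a + x)) * ((d + 1) * z powr (d + 1 - 1))"
          using that a_pos \<Delta>_pos by (intro MVT2) (auto intro!: derivative_eq_intros)
        then obtain z where z: "a + x < z"
          "(a + x + \<Delta>) powr (d + 1) - (a + x) powr (d + 1) = \<Delta> * ((d + 1) * z powr d)"
          by auto
        have "F2 x = - (\<Delta> * z powr d)"
          unfolding F2_def using z(2) d_gt by (simp add: field_simps)
        moreover have "z powr d \<le> (a + x) powr d"
          using z(1) that a_pos d_neg by (intro powr_mono2') auto
        ultimately show ?thesis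
          using \<Delta>_pos by simp
      qed
      then show "eventually (\<lambda>x. norm (F2 x) \<le> \<Delta> * (a + x) powr d) at_top"
        by (intro eventually_at_top_linorderI[of 0])
      have "filterlim (\<lambda>x. a + x) at_top at_top"
        by (intro filterlim_tendsto_add_at_top[OF tendsto_const filterlim_ident])
      then have "((\<lambda>x. (a + x) powr d) \<longlongrightarrow> 0) at_top"
        by (rule tendsto_neg_powr[OF d_neg])
      from tendsto_mult_left[OF this, of \<Delta>] show "((\<lambda>x. \<Delta> * (a + x) powr d) \<longlongrightarrow> 0) at_top"
        by simp
    qed
  qed simp
  have "(\<integral>\<^sup>+u. ennreal (?g u) \<partial>lborel) = (\<integral>\<^sup>+x. ennreal (?g (0 + (-1) * x)) \<partial>lborel)"
    by (subst nn_integral_real_affine[where c = "-1" and t = 0]) auto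
  also have "\<dots> = (\<integral>\<^sup>+x. ennreal (f1 x) * indicator {-\<Delta>..0} x + ennreal (f2 x) * indicator {0..} x \<partial>lborel)"
  proof (intro nn_integral_cong_AE eventually_mono[OF AE_lborel_singleton[of 0]])
    fix x :: real assume "x \<noteq> 0"
    then consider "x < - \<Delta>" | "- \<Delta> \<le> x" "x < 0" | "0 < x"
      by linarith
    then show "ennreal (?g (0 + - 1 * x))
        = ennreal (f1 x) * indicator {- \<Delta>..0} x + ennreal (f2 x) * indicator {0..} x"
      by cases (use \<Delta>_pos in \<open>auto simp: increment_kernel_def f1_def f2_def max_absorb1 max_absorb2 ac_simps\<close>)
  qed
  also have "\<dots> = ennreal (F1 0 - F1 (-\<Delta>)) + ennreal (0 - F2 0)"
    by (subst nn_integral_add) (auto simp: I1 I2)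
  also have "\<dots> = ennreal ((F1 0 - F1 (-\<Delta>)) + (0 - F2 0))"
  proof (rule ennreal_plus[symmetric])
    have "DERIV F1 x :> f1 x" if "- \<Delta> \<le> x" for x
      unfolding F1_def f1_def using d_gt a_pos that by (auto intro!: derivative_eq_intros)
    moreover have "0 \<le> f1 x" if "- \<Delta> \<le> x" for x
      using that a_pos d_neg by (auto simp: f1_def intro!: powr_mono2')
    ultimately show "0 \<le> F1 0 - F1 (-\<Delta>)"
      using DERIV_nonneg_imp_nondecreasing[of "-\<Delta>" 0 F1] \<Delta>_pos by force
    show "0 \<le> 0 - F2 0"
      unfolding F2_def using a_pos d_gt \<Delta>_pos
      by (auto simp: divide_le_0_iff intro!: powr_mono2)
  qed
  also have "(F1 0 - F1 (-\<Delta>)) + (0 - F2 0) = \<Delta> * a powr d"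
    by (simp add: F1_def F2_def diff_divide_distrib add_divide_distrib)
  finally show "(\<integral>\<^sup>+u. ennreal (?g u) \<partial>lborel) = ennreal (\<Delta> * a powr d)" .
qed (use increment_kernel_nonneg \<Delta>_pos in auto)

text \<open>
  Dominated convergence for the quotient of the integrand by \<open>(H + a)\<^sup>d\<^sup>-\<^sup>1\<close>. Writing
  \<open>g\<close> for the increment kernel, the quotient
  \<open>g(u - H) / (H + a)\<^sup>d\<^sup>-\<^sup>1\<close> has no bound uniform in \<open>u\<close> and \<open>H\<close>. But the other
  factor \<open>g(u)\<close> vanishes for \<open>u \<ge> \<Delta>\<close>, and for \<open>u \<le> \<Delta> \<le> H\<close> the base \<open>a + H - u\<close> is
  at least \<open>a / (a + \<Delta>)\<close> times \<open>H + a\<close>, which gives the constant \<open>K\<close>.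
\<close>

lemma increment_kernel_correlation_asymp:
  "(\<lambda>H. \<integral>u. increment_kernel a d \<Delta> (u - H) * increment_kernel a d \<Delta> u \<partial>lborel)
    \<sim>[at_top] (\<lambda>H. \<bar>d\<bar> * a powr d * \<Delta>\<^sup>2 * (H + a) powr (d - 1))"
proof (rule asymp_equivI'_const)
  let ?g = "increment_kernel a d \<Delta>"
  have int: "integrable lborel ?g" and integral: "(\<integral>u. ?g u \<partial>lborel) = \<Delta> * a powr d"
    using has_bochner_integral_increment_kernel
    by (auto simp: has_bochner_integral_iff)
  define K where "K = \<bar>d\<bar> * \<Delta> * (a / (a + \<Delta>)) powr (d - 1)"
  have g_eq: "?g (u - H) = (a + (H - u)) powr d - (a + (H - u) + \<Delta>) powr d" if "u \<le> H" for u H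
    using that \<Delta>_pos by (simp add: increment_kernel_def algebra_simps)
  have "((\<lambda>H. \<integral>u. ?g (u - H) / (H + a) powr (d - 1) * ?g u \<partial>lborel)
      \<longlongrightarrow> (\<integral>u. \<bar>d\<bar> * \<Delta> * ?g u \<partial>lborel)) at_top"
  proof (rule integral_dominated_convergence_at_top)
    show "integrable lborel (\<lambda>u. K * ?g u)"
      using int by simp
    show "AE u in lborel. ((\<lambda>H. ?g (u - H) / (H + a) powr (d - 1) * ?g u) \<longlongrightarrow> \<bar>d\<bar> * \<Delta> * ?g u) at_top"
    proof (rule AE_I2, rule tendsto_mult_right)
      fix u :: real
      have ratio: "((\<lambda>H. ((c + H) / (H + a)) powr (d - 1)) \<longlongrightarrow> 1) at_top" for c
      proof -
        have "((\<lambda>H. (c + H) / (H + a)) \<longlongrightarrow> 1) at_top"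
          by real_asymp
        from tendsto_powr[OF this tendsto_const, of "d - 1"] show ?thesis
          by simp
      qed
      have lim: "((\<lambda>H. \<bar>d\<bar> * \<Delta> * ((c + H) / (H + a)) powr (d - 1)) \<longlongrightarrow> \<bar>d\<bar> * \<Delta>) at_top" for c
        using tendsto_mult_left[OF ratio, of "\<bar>d\<bar> * \<Delta>"] by simp
      have bounds: "\<bar>d\<bar> * \<Delta> * ((a - u + \<Delta> + H) / (H + a)) powr (d - 1) \<le> ?g (u - H) / (H + a) powr (d - 1)"
        "?g (u - H) / (H + a) powr (d - 1) \<le> \<bar>d\<bar> * \<Delta> * ((a - u + H) / (H + a)) powr (d - 1)"
        if "max 0 u \<le> H" for H
      proof -
        have eq: "a - u + \<Delta> + H = a + (H - u) + \<Delta>" "a - u + H = a + (H - u)"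
          by simp_all
        have nonneg: "0 \<le> a + (H - u) + \<Delta>" "0 \<le> a + (H - u)" "0 \<le> H + a" "u \<le> H"
          using that a_pos \<Delta>_pos by auto
        note bounds = powr_increment_bounds[of "a + (H - u)" \<Delta> d,
            THEN divide_right_mono, of "(H + a) powr (d - 1)"]
        show "\<bar>d\<bar> * \<Delta> * ((a - u + \<Delta> + H) / (H + a)) powr (d - 1) \<le> ?g (u - H) / (H + a) powr (d - 1)"
          "?g (u - H) / (H + a) powr (d - 1) \<le> \<bar>d\<bar> * \<Delta> * ((a - u + H) / (H + a)) powr (d - 1)"
          unfolding eq g_eq[OF nonneg(4)] powr_divide
            times_divide_eq_right
          by (intro bounds; use that a_pos d_neg \<Delta>_pos in simp)+
      qed
      show "((\<lambda>H. ?g (u - H) / (H + a) powr (d - 1)) \<longlongrightarrow> \<bar>d\<bar> * \<Delta>) at_top"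
      proof (rule tendsto_sandwich[OF _ _ lim lim])
        show "eventually (\<lambda>H. \<bar>d\<bar> * \<Delta> * ((a - u + \<Delta> + H) / (H + a)) powr (d - 1)
            \<le> ?g (u - H) / (H + a) powr (d - 1)) at_top"
          using eventually_ge_at_top[of "max 0 u"] by eventually_elim (rule bounds(1))
        show "eventually (\<lambda>H. ?g (u - H) / (H + a) powr (d - 1)
            \<le> \<bar>d\<bar> * \<Delta> * ((a - u + H) / (H + a)) powr (d - 1)) at_top"
          using eventually_ge_at_top[of "max 0 u"] by eventually_elim (rule bounds(2))
      qed
    qed
    show "eventually (\<lambda>H. AE u in lborel. norm (?g (u - H) / (H + a) powr (d - 1) * ?g u) \<le> K * ?g u) at_top"
      using eventually_ge_at_top[of \<Delta>]
    proof (eventually_elim, intro AE_I2)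
      fix H u :: real assume H: "\<Delta> \<le> H"
      show "norm (?g (u - H) / (H + a) powr (d - 1) * ?g u) \<le> K * ?g u"
      proof (cases "u \<le> \<Delta>")
        case True
        have "?g (u - H) \<le> \<bar>d\<bar> * \<Delta> * (a + (H - u)) powr (d - 1)"
          using powr_increment_bounds(2)[of "a + (H - u)" \<Delta> d] g_eq[of u H] True H a_pos d_neg \<Delta>_pos
          by simp
        also have "\<dots> \<le> \<bar>d\<bar> * \<Delta> * (a / (a + \<Delta>) * (H + a)) powr (d - 1)"
        proof (intro mult_left_mono powr_mono2')
          have "a * (H + a) \<le> (a + (H - \<Delta>)) * (a + \<Delta>)"
            using mult_nonneg_nonneg[of \<Delta> "H - \<Delta>"] H \<Delta>_pos by (simp add: algebra_simps)
          then have "a / (a + \<Delta>) * (H + a) \<le> a + (H - \<Delta>)"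
            using a_pos \<Delta>_pos by (simp add: field_simps)
          then show "a / (a + \<Delta>) * (H + a) \<le> a + (H - u)"
            using True by simp
          show "0 < a / (a + \<Delta>) * (H + a)"
            using a_pos \<Delta>_pos H by simp
        qed (use d_neg \<Delta>_pos in \<open>auto simp: mult_nonpos_nonneg\<close>)
        also have "\<dots> = K * (H + a) powr (d - 1)"
          by (simp only: K_def powr_mult mult.assoc)
        finally have "?g (u - H) / (H + a) powr (d - 1) \<le> K"
          using H a_pos \<Delta>_pos by (simp add: pos_divide_le_eq)
        then have "?g (u - H) / (H + a) powr (d - 1) * ?g u \<le> K * ?g u"
          by (intro mult_right_mono increment_kernel_nonneg)
        then show ?thesis
          by (simp add: abs_mult increment_kernel_nonneg abs_of_nonneg)
      qed (simp add: increment_kernel_eq_0)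
    qed
  qed measurable
  then have "((\<lambda>H. (\<integral>u. ?g (u - H) * ?g u \<partial>lborel) / (H + a) powr (d - 1))
      \<longlongrightarrow> \<bar>d\<bar> * \<Delta> * (\<Delta> * a powr d)) at_top"
    by (simp add: integral)
  then show "((\<lambda>H. (\<integral>u. ?g (u - H) * ?g u \<partial>lborel) / (H + a) powr (d - 1))
      \<longlongrightarrow> \<bar>d\<bar> * a powr d * \<Delta>\<^sup>2) at_top"
    by (simp add: power2_eq_square mult_ac)
  show "\<bar>d\<bar> * a powr d * \<Delta>\<^sup>2 \<noteq> 0"
    using d_neg a_pos \<Delta>_pos by simp
qed

end

theorem proposition4p6:
  fixes a d \<Delta> :: real
    and N :: "'b measure" and S :: "real \<Rightarrow> 'b \<Rightarrow> real"
    and M :: "'a measure" and S1 S2 X :: "real \<Rightarrow> 'a \<Rightarrow> real"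
  assumes "-1/2 < d" and "d < 0" and "0 < a" and "0 < \<Delta>"
    and "subordinator N S"
    and "integrable N (\<lambda>\<omega>. (S 1 \<omega>)\<^sup>2)"
    and "independent_copies N S M S1 S2"
    and "\<And>t. has_L2_integral M (two_sided S1 S2) (mvn_kernel a d t) (X t)"
  shows "\<exists>\<gamma> :: real \<Rightarrow> real.
     (\<forall>s t h. 0 < h \<and> s + \<Delta> \<le> t \<and> t - s = h * \<Delta> \<longrightarrow>
        covariance M (\<lambda>\<omega>. X (t + \<Delta>) \<omega> - X t \<omega>) (\<lambda>\<omega>. X (s + \<Delta>) \<omega> - X s \<omega>) = \<gamma> h) \<and>
     \<gamma> \<sim>[at_top] (\<lambda>h. prob_space.variance N (S 1) * \<bar>d\<bar> * a powr d * \<Delta>\<^sup>2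
                          * (h * \<Delta> + a) powr (d - 1))"
proof -
  let ?v = "prob_space.variance N (S 1)" and ?f = "mvn_kernel a d" and ?g = "increment_kernel a d \<Delta>"
  define J where "J H = (\<integral>u. ?g (u - H) * ?g u \<partial>lborel)" for H
  have d: "-1 < d"
    using assms(1) by simp
  interpret N: finite_variance_subordinator N S
    using assms(5,6) by unfold_locales
  interpret prob_space M
    using assms(7) by (simp add: independent_copies_def subordinator_def levy_process_def)
  have sqX: "square_integrable M (X t)" for t
    using assms(8)[of t] by (simp add: has_L2_integral_def square_integrable_def)
  have sqf: "square_integrable lborel (?f t)" for t
  proof -
    obtain p where "\<And>n. valid_step (p n)"
      "(\<lambda>n. \<integral>\<^sup>+u. ennreal ((step_fun (p n) u - ?f t u)\<^sup>2) \<partial>lborel) \<longlonglongrightarrow> 0"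
      using assms(8)[of t] unfolding has_L2_integral_def by blast
    then show ?thesis
      by (intro square_integrable_limit_of_steps) auto
  qed
  have cov_X: "covariance M (X t) (X s) = ?v * (\<integral>u. ?f t u * ?f s u \<partial>lborel)" for s t
    by (intro covariance_two_sided_L2_integral[OF N.finite_variance_subordinator_axioms assms(7,8,8)])
      measurable
  have cov: "covariance M (\<lambda>\<omega>. X (t + \<Delta>) \<omega> - X t \<omega>) (\<lambda>\<omega>. X (s + \<Delta>) \<omega> - X s \<omega>)
      = ?v * J (t - s)" for s t
  proof -
    have "covariance M (\<lambda>\<omega>. X (t + \<Delta>) \<omega> - X t \<omega>) (\<lambda>\<omega>. X (s + \<Delta>) \<omega> - X s \<omega>)
        = ?v * (((\<integral>u. ?f (t + \<Delta>) u * ?f (s + \<Delta>) u \<partial>lborel) - (\<integral>u. ?f (t + \<Delta>) u * ?f s u \<partial>lborel))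
          - ((\<integral>u. ?f t u * ?f (s + \<Delta>) u \<partial>lborel) - (\<integral>u. ?f t u * ?f s u \<partial>lborel)))"
      by (simp add: covariance_diff_left covariance_diff_right square_integrable_diff sqX cov_X
          algebra_simps)
    also have "\<dots> = ?v * (\<integral>u. (?f (t + \<Delta>) u * ?f (s + \<Delta>) u - ?f (t + \<Delta>) u * ?f s u)
          - (?f t u * ?f (s + \<Delta>) u - ?f t u * ?f s u) \<partial>lborel)"
      using square_integrable_mult[OF sqf sqf] by simp
    also have "\<dots> = ?v * (\<integral>u. (?f (t + \<Delta>) u - ?f t u) * (?f (s + \<Delta>) u - ?f s u) \<partial>lborel)"
      by (simp add: algebra_simps)
    also have "\<dots> = ?v * (\<integral>u. ?g (u - t) * ?g (u - s) \<partial>lborel)"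
      by (simp add: mvn_kernel_increment)
    also have "\<dots> = ?v * J (t - s)"
      unfolding J_def by (subst lborel_integral_real_affine[where c = 1 and t = s]) (auto simp: algebra_simps)
    finally show ?thesis .
  qed
  have "filterlim (\<lambda>h. h * \<Delta>) at_top at_top"
    using assms(4) by (intro filterlim_at_top_mult_tendsto_pos[OF tendsto_const _ filterlim_ident]) auto
  from asymp_equiv_compose'[OF increment_kernel_correlation_asymp[OF d assms(2-4)] this]
  have "(\<lambda>h. J (h * \<Delta>)) \<sim>[at_top] (\<lambda>h. \<bar>d\<bar> * a powr d * \<Delta>\<^sup>2 * (h * \<Delta> + a) powr (d - 1))"
    unfolding J_def .
  from asymp_equiv_mult[OF asymp_equiv_refl[of "\<lambda>_. ?v"] this]
  have "(\<lambda>h. ?v * J (h * \<Delta>)) \<sim>[at_top]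
      (\<lambda>h. ?v * \<bar>d\<bar> * a powr d * \<Delta>\<^sup>2 * (h * \<Delta> + a) powr (d - 1))"
    by (simp only: mult.assoc)
  with cov show ?thesis
    by (intro exI[of _ "\<lambda>h. ?v * J (h * \<Delta>)"]) auto
qed

end
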